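(* Let $s\in (0,\frac12)$. There exists a simply connected domain $\mathcal{D}\subset\mathbb{R}^2$ which satisfies the extended finite ball condition, i.e. $\overline{BC}(\mathcal{D})<\infty$, and for which the fractional Poincaré inequality FP($s$) does not hold, i.e. $P_{2,s}^2(\mathcal{D})=0$.
   Context: $|E|$ denotes the Lebesgue measure of a measurable set $E\subset\mathbb{R}^n$, $B_r(x)$ the ball of radius $r$ centered at $x$, and $\Omega^c=\mathbb{R}^n\setminus\Omega$. For an open set $\Omega\subset\mathbb{R}^n$, define $\overline{BC}(\Omega)=\sup\{r : |B_r(x)\cap\Omega^c|=0,\ x\in\Omega\}$ (supremum over all $r>0$ for which some $x\in\Omega$ satisfies the condition). $\Omega$ satisfies the extended finite ball condition if $\overline{BC}(\Omega)<\infty$. For $s\in(0,1)$, $H^s_\Omega(\mathbb{R}^n)$ is the closure of $C_c^\infty(\Omega)$ (functions extended by zero to $\mathbb{R}^n$) with respect to the norm $$\|u\|_{H^s(\mathbb{R}^n)}=\|u\|_{L^2(\Omega)}+\left(\int_{\mathbb{R}^n}\int_{\mathbb{R}^n}\frac{(u(x)-u(y))^2}{|x-y|^{n+2s}}\,dx\,dy\right)^{1/2}.$$ The quantity (the superscript 2 is a label, not a power) $$P_{n,s}^2(\Omega)=\inf_{u\in H^s_\Omega(\mathbb{R}^n),\,u\neq0}\frac{\int_{\mathbb{R}^n}\int_{\mathbb{R}^n}\frac{(u(x)-u(y))^2}{|x-y|^{n+2s}}\,dx\,dy}{\int_\Omega u^2}$$ is the best constant; FP($s$) holds for $\Omega$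 if $P_{n,s}^2(\Omega)>0$. *)

theory Defs
  imports "HOL-Analysis.Analysis"
begin

text \<open>The spaces \<open>\<real>\<^sup>n\<close> are represented by a type \<open>'a :: euclidean_space\<close>, with \<open>n = DIM('a)\<close>.\<close>

definition BC :: "'a::euclidean_space set \<Rightarrow> ennreal" where
  "BC \<Omega> = Sup {ennreal r | r. 0 < r \<and> (\<exists>x\<in>\<Omega>. emeasure lebesgue (ball x r \<inter> - \<Omega>) = 0)}"

text \<open>\<open>Ck k f\<close>: \<open>f\<close> is of class \<open>C\<^sup>k\<close> on the whole space; \<open>frechet_derivative f (at x) i\<close> is the
  partial derivative of \<open>f\<close> at \<open>x\<close> in the coordinate direction \<open>i\<close>.\<close>

primrec Ck :: "nat \<Rightarrow> ('a::euclidean_space \<Rightarrow> real) \<Rightarrow> bool" where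
  "Ck 0 f \<longleftrightarrow> continuous_on UNIV f"
| "Ck (Suc k) f \<longleftrightarrow> f differentiable_on UNIV \<and>
     (\<forall>i\<in>Basis. Ck k (\<lambda>x. frechet_derivative f (at x) i))"

text \<open>Test functions on \<open>\<Omega>\<close>, already extended by zero to the whole space.\<close>

definition Cc_infinity :: "'a::euclidean_space set \<Rightarrow> ('a \<Rightarrow> real) set" where
  "Cc_infinity \<Omega> = {\<phi>. (\<forall>k. Ck k \<phi>) \<and> compact (closure {x. \<phi> x \<noteq> 0}) \<and> closure {x. \<phi> x \<noteq> 0} \<subseteq> \<Omega>}"

text \<open>The Gagliardo energy. On the diagonal the quotient is \<open>0 / 0 = 0\<close>; the diagonal is a null set.\<close>

definition gagliardo :: "real \<Rightarrow> ('a::euclidean_space \<Rightarrow> real) \<Rightarrow> ennreal" where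
  "gagliardo s u = (\<integral>\<^sup>+ y. (\<integral>\<^sup>+ x. ennreal ((u x - u y)\<^sup>2 / norm (x - y) powr (real DIM('a) + 2 * s))
     \<partial>lebesgue) \<partial>lebesgue)"

definition L2sq :: "'a::euclidean_space set \<Rightarrow> ('a \<Rightarrow> real) \<Rightarrow> ennreal" where
  "L2sq \<Omega> u = (\<integral>\<^sup>+ x \<in> \<Omega>. ennreal ((u x)\<^sup>2) \<partial>lebesgue)"

text \<open>The ambient space \<open>H\<^sup>s(\<real>\<^sup>n)\<close>. Its elements are functions, not equivalence classes; accordingly
  \<open>u \<noteq> 0\<close> below means that \<open>u\<close> does not vanish almost everywhere.\<close>

definition Hs :: "real \<Rightarrow> ('a::euclidean_space \<Rightarrow> real) set" where
  "Hs s = {u \<in> borel_measurable lebesgue. L2sq UNIV u < \<infinity> \<and> gagliardo s u < \<infinity>}"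

text \<open>Only meaningful on \<open>Hs s\<close>, where both quantities under the square roots are finite.\<close>

definition Hs_norm :: "real \<Rightarrow> 'a::euclidean_space set \<Rightarrow> ('a \<Rightarrow> real) \<Rightarrow> real" where
  "Hs_norm s \<Omega> u = sqrt (enn2real (L2sq \<Omega> u)) + sqrt (enn2real (gagliardo s u))"

text \<open>The closure of the test functions in \<open>H\<^sup>s(\<real>\<^sup>n)\<close>. For \<open>0 < s < 1\<close> test functions lie in \<open>Hs s\<close>,
  so the norm is applied to a difference of two elements of \<open>Hs s\<close>.\<close>

definition Hs_zero :: "real \<Rightarrow> 'a::euclidean_space set \<Rightarrow> ('a \<Rightarrow> real) set" where
  "Hs_zero s \<Omega> = {u \<in> Hs s. \<forall>\<epsilon>>0. \<exists>\<phi>\<in>Cc_infinity \<Omega>. Hs_norm s \<Omega> (\<lambda>x. u x - \<phi> x) < \<epsilon>}"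

text \<open>The best constant \<open>P\<^sup>2\<^bsub>n,s\<^esub>(\<Omega>)\<close>, where the superscript is a label and \<open>n = DIM('a)\<close>.\<close>

definition P2 :: "real \<Rightarrow> 'a::euclidean_space set \<Rightarrow> ennreal" where
  "P2 s \<Omega> = (INF u \<in> {u \<in> Hs_zero s \<Omega>. \<not> (AE x in lebesgue. u x = 0)}. gagliardo s u / L2sq \<Omega> u)"

definition extended_finite_ball :: "'a::euclidean_space set \<Rightarrow> bool" where
  "extended_finite_ball \<Omega> \<longleftrightarrow> BC \<Omega> < \<infinity>"

definition FP :: "real \<Rightarrow> 'a::euclidean_space set \<Rightarrow> bool" where
  "FP s \<Omega> \<longleftrightarrow> P2 s \<Omega> > 0"

end

theory Submission
  imports Defs
begin

text \<open>
  The domain is a comb: the half-plane \<open>y > -1\<close> from which, above the line \<open>y = 0\<close>, closed vertical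
  half-strips (the teeth) around the zeros of \<open>sin x\<close> are removed. The teeth extend to \<open>y = \<infinity>\<close>, so
  sliding points down into the strip \<open>-1 < y < 0\<close> contracts the domain (\<open>contractible_comb\<close>). Every
  tooth has positive width and consecutive teeth are at distance at most \<open>\<pi>\<close>, so no large ball can be
  contained in the domain up to a null set (\<open>BC_comb_le\<close>). But the teeth become thinner as
  \<open>\<bar>x\<bar> \<rightarrow> \<infinity>\<close>: a tooth at abscissa \<open>x\<close> has width of order \<open>1 / \<bar>x\<bar>\<close>. For \<open>s < 1 / 2\<close> thin teeth are
  almost invisible to the energy.

  The quantitative tool is \<open>gagliardo_le_Lipschitz\<close>: a function with values in \<open>[0, 1]\<close> and Lipschitz
  constant \<open>L\<close> that vanishes off a set of measure \<open>m\<close> has energy at most \<open>C m L\<^sup>2\<^sup>s\<close>. In a window of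
  size \<open>n\<close> around a point of abscissa \<open>n \<pi>\<close>, the test function is \<open>u = bump - tooth_bump\<close>, where \<open>bump\<close> is a
  cutoff at scale \<open>n\<close> and \<open>tooth_bump\<close> is its product with a cutoff at scale \<open>1 / n\<close> around the
  teeth, so that \<open>u\<close> vanishes near the teeth. Here \<open>bump\<close> has \<open>m \<approx> n\<^sup>2\<close> and
  \<open>L \<approx> 1 / n\<close>; there are about \<open>n\<close> teeth of height \<open>n\<close> and width \<open>1 / n\<close>, so \<open>tooth_bump\<close> has
  \<open>m \<approx> n\<close> and \<open>L \<approx> n\<close>. As \<open>\<integral> u\<^sup>2 \<ge> 2 n\<^sup>2\<close> for large \<open>n\<close>, the Rayleigh quotient of \<open>u\<close> is at most a constant times
  \<open>n powr (-2 s) + n powr (2 s - 1)\<close>, which tends to \<open>0\<close> because \<open>0 < s < 1 / 2\<close>.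
\<close>

section \<open>Closure properties of the classes \<open>C\<^sup>k\<close>\<close>

text \<open>Any family of pointwise derivatives serves to verify or to use the recursive clause of \<open>Ck\<close>, because
  Frechet derivatives on the whole space are unique; the proofs below can so work with explicit derivatives.\<close>

lemma Ck_SucI:
  assumes "\<And>x. (f has_derivative f' x) (at x)" and "\<And>i. i \<in> Basis \<Longrightarrow> Ck k (\<lambda>x. f' x i)"
  shows "Ck (Suc k) f"
proof -
  have "frechet_derivative f (at x) = f' x" for x
    using frechet_derivative_at[OF assms(1)] by simp
  moreover have "f differentiable_on UNIV"
    using assms(1) by (auto simp: differentiable_on_def differentiable_def)
  ultimately show ?thesis
    using assms(2) by simp
qed

lemma Ck_SucE:
  assumes "Ck (Suc k) f"
  obtains f' where "\<And>x. (f has_derivative f' x) (at x)"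
    and "\<And>i. i \<in> Basis \<Longrightarrow> Ck k (\<lambda>x. f' x i)"
proof -
  have "(f has_derivative frechet_derivative f (at x)) (at x)" for x
    using assms frechet_derivative_works by (auto simp: differentiable_on_def)
  moreover have "Ck k (\<lambda>x. frechet_derivative f (at x) i)" if "i \<in> Basis" for i
    using assms that by simp
  ultimately show thesis
    using that[of "\<lambda>x. frechet_derivative f (at x)"] by blast
qed

lemma Ck_SucD: "Ck (Suc k) f \<Longrightarrow> Ck k f"
proof (induction k arbitrary: f)
  case 0
  then show ?case by (auto intro: differentiable_imp_continuous_on)
next
  case (Suc k)
  then show ?case by auto
qed

lemma Ck_const: "Ck k (\<lambda>x. c)"
proof (induction k arbitrary: c)
  case (Suc k)
  then show ?case by (intro Ck_SucI[where f' = "\<lambda>x h. 0"]) auto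
qed auto

lemma Ck_bounded_linear:
  assumes "bounded_linear f"
  shows "Ck k f"
proof (cases k)
  case 0
  then show ?thesis using assms by (simp add: linear_continuous_on)
next
  case (Suc m)
  show ?thesis unfolding Suc
    using assms by (intro Ck_SucI[where f' = "\<lambda>x. f"])
      (auto intro: Ck_const bounded_linear_imp_has_derivative)
qed

lemma Ck_add: "Ck k f \<Longrightarrow> Ck k g \<Longrightarrow> Ck k (\<lambda>x. f x + g x)"
proof (induction k arbitrary: f g)
  case 0
  then show ?case by (auto intro: continuous_on_add)
next
  case (Suc k)
  obtain f' where f': "\<And>x. (f has_derivative f' x) (at x)" "\<And>i. i \<in> Basis \<Longrightarrow> Ck k (\<lambda>x. f' x i)"
    using Ck_SucE[OF Suc.prems(1)] by blast
  obtain g' where g': "\<And>x. (g has_derivative g' x) (at x)" "\<And>i. i \<in> Basis \<Longrightarrow> Ck k (\<lambda>x. g' x i)"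
    using Ck_SucE[OF Suc.prems(2)] by blast
  show ?case
    by (rule Ck_SucI[OF has_derivative_add[OF f'(1) g'(1)]]) (intro Suc.IH f' g')
qed

text \<open>The product rule expresses the partial derivatives of \<open>f g\<close> through products of \<open>C\<^sup>k\<close> functions; one
  factor in each product is an undifferentiated function, for which one order of smoothness is dropped.\<close>

lemma Ck_mult: "Ck k f \<Longrightarrow> Ck k g \<Longrightarrow> Ck k (\<lambda>x. f x * g x)"
proof (induction k arbitrary: f g)
  case 0
  then show ?case by (auto intro: continuous_on_mult)
next
  case (Suc k)
  obtain f' where f': "\<And>x. (f has_derivative f' x) (at x)" "\<And>i. i \<in> Basis \<Longrightarrow> Ck k (\<lambda>x. f' x i)"
    using Ck_SucE[OF Suc.prems(1)] by blast
  obtain g' where g': "\<And>x. (g has_derivative g' x) (at x)" "\<And>i. i \<in> Basis \<Longrightarrow> Ck k (\<lambda>x. g' x i)"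
    using Ck_SucE[OF Suc.prems(2)] by blast
  show ?case
    by (rule Ck_SucI[OF has_derivative_mult[OF f'(1) g'(1)]])
       (intro Ck_add Suc.IH f' g' Ck_SucD[OF Suc.prems(1)] Ck_SucD[OF Suc.prems(2)])
qed

text \<open>By the chain rule \<open>\<partial>\<^sub>i (f \<circ> g) = (f' \<circ> g) \<cdot> \<partial>\<^sub>i g\<close>, so the induction reduces to products.\<close>

lemma Ck_compose:
  fixes f :: "real \<Rightarrow> real"
  shows "Ck k f \<Longrightarrow> Ck k g \<Longrightarrow> Ck k (\<lambda>x. f (g x))"
proof (induction k arbitrary: f g)
  case 0
  then show ?case by (auto intro: continuous_on_compose2[of UNIV])
next
  case (Suc k)
  obtain f' where f': "\<And>x. (f has_derivative f' x) (at x)" "\<And>i. i \<in> Basis \<Longrightarrow> Ck k (\<lambda>x. f' x i)"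
    using Ck_SucE[OF Suc.prems(1)] by blast
  obtain g' where g': "\<And>x. (g has_derivative g' x) (at x)" "\<And>i. i \<in> Basis \<Longrightarrow> Ck k (\<lambda>x. g' x i)"
    using Ck_SucE[OF Suc.prems(2)] by blast
  have 1: "f' y h = f' y 1 * h" for y h
    using linear_cmul[OF has_derivative_linear[OF f'(1)], of y h 1] by (simp add: mult.commute)
  have "Ck k (\<lambda>x. f' (g x) 1 * g' x i)" if "i \<in> Basis" for i
    using Ck_mult[OF Suc.IH[OF f'(2) Ck_SucD[OF Suc.prems(2)]] g'(2)[OF that]] by simp
  moreover have "(\<lambda>x. f' (g x) (g' x i)) = (\<lambda>x. f' (g x) 1 * g' x i)" for i
    by (rule ext) (rule 1)
  ultimately have "Ck k (\<lambda>x. f' (g x) (g' x i))" if "i \<in> Basis" for i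
    using that by metis
  then show ?case
    by (rule Ck_SucI[OF has_derivative_compose[OF g'(1) f'(1)]])
qed

lemma Ck_diff:
  assumes "Ck k f" "Ck k g"
  shows "Ck k (\<lambda>x. f x - g x)"
  using Ck_add[OF assms(1) Ck_mult[OF Ck_const[of k "-1"] assms(2)]] by simp

lemma Ck_DERIV:
  fixes f :: "real \<Rightarrow> real"
  assumes "\<And>x. (f has_real_derivative f' x) (at x)" and "Ck k f'"
  shows "Ck (Suc k) f"
  using assms by (intro Ck_SucI[where f' = "\<lambda>x h. f' x * h"]) (auto simp: has_field_derivative_def)

text \<open>The linear combinations of sine and cosine are closed under differentiation.\<close>

lemma Ck_sin: "Ck k (sin :: real \<Rightarrow> real)"
proof -
  have "Ck k (\<lambda>x::real. a * sin x + b * cos x)" for a b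
  proof (induction k arbitrary: a b)
    case 0
    show ?case by (auto intro!: continuous_intros)
  next
    case (Suc k)
    show ?case
      by (rule Ck_DERIV[OF _ Suc[of "-b" a]]) (auto intro!: derivative_eq_intros)
  qed
  from this[of 1 0] show ?thesis by simp
qed

section \<open>A smooth cutoff function\<close>

lemma poly_over_exp_tendsto_0:
  "((\<lambda>y::real. poly p y / exp y) \<longlongrightarrow> 0) at_top"
proof -
  have "((\<lambda>y::real. \<Sum>i\<le>degree p. coeff p i * (y ^ i / exp y)) \<longlongrightarrow> (\<Sum>i\<le>degree p. coeff p i * 0)) at_top"
    by (intro tendsto_intros tendsto_power_div_exp_0)
  then show ?thesis by (simp add: poly_altdef sum_divide_distrib)
qed

text \<open>The polynomial \<open>p\<close> makes the family closed under differentiation (\<open>flat_deriv\<close>), which yields smoothness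
  at the origin; \<open>flat 1\<close> is the classical smooth function \<open>exp (-1 / t)\<close> extended by \<open>0\<close>.\<close>

definition flat :: "real poly \<Rightarrow> real \<Rightarrow> real" where
  "flat p t = (if t > 0 then poly p (1 / t) * exp (- 1 / t) else 0)"

lemma flat_deriv:
  "(flat p has_real_derivative flat ([:0, 0, 1:] * (p - pderiv p)) t) (at t)"
proof -
  consider "t > 0" | "t < 0" | "t = 0" by linarith
  then show ?thesis
  proof cases
    case 1
    have "((\<lambda>t. poly p (1 / t) * exp (- 1 / t)) has_real_derivative
        flat ([:0, 0, 1:] * (p - pderiv p)) t) (at t)"
      using 1 by (auto intro!: derivative_eq_intros simp: flat_def power2_eq_square field_simps)
    then show ?thesis
      by (rule has_field_derivative_transform_within_open[where S = "{0<..}"])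
         (use 1 in \<open>auto simp: flat_def\<close>)
  next
    case 2
    have "((\<lambda>t. 0) has_real_derivative flat ([:0, 0, 1:] * (p - pderiv p)) t) (at t)"
      using 2 by (auto simp: flat_def)
    then show ?thesis
      by (rule has_field_derivative_transform_within_open[where S = "{..<0}"])
         (use 2 in \<open>auto simp: flat_def\<close>)
  next
    case 3
    have "((\<lambda>t. poly (pCons 0 p) (inverse t) / exp (inverse t)) \<longlongrightarrow> 0) (at_right 0)"
      by (rule filterlim_compose[OF poly_over_exp_tendsto_0 filterlim_inverse_at_top_right])
    then have "((\<lambda>t. flat p t / t) \<longlongrightarrow> 0) (at_right 0)"
      by (rule Lim_transform_eventually)
         (auto simp: eventually_at_filter flat_def exp_minus field_simps)
    moreover have "((\<lambda>t. flat p t / t) \<longlongrightarrow> 0) (at_left 0)"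
      by (rule Lim_transform_eventually[of "\<lambda>_. 0"])
         (auto simp: eventually_at_filter flat_def)
    ultimately have "((\<lambda>t. flat p t / t) \<longlongrightarrow> 0) (at 0)"
      using filterlim_split_at by blast
    then show ?thesis
      using 3 by (simp add: has_field_derivative_iff flat_def[of _ 0])
  qed
qed

lemma Ck_flat: "Ck k (flat p)"
proof (induction k arbitrary: p)
  case 0
  show ?case
    using DERIV_isCont[OF flat_deriv] by (simp add: continuous_at_imp_continuous_on)
next
  case (Suc k)
  then show ?case by (rule Ck_DERIV[OF flat_deriv])
qed

text \<open>The derivative is \<open>y\<^sup>2 exp (-y)\<close> with \<open>y = 1 / t\<close>, and \<open>y \<le> (1 + y / 4)\<^sup>2 \<le> exp (y / 2)\<close>.\<close>

lemma flat_1_lipschitz: "\<bar>flat 1 x - flat 1 y\<bar> \<le> \<bar>x - y\<bar>"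
proof -
  have "\<bar>flat [:0, 0, 1:] t\<bar> \<le> 1" for t
  proof (cases "t > 0")
    case True
    define y where "y = 1 / t"
    have y: "y > 0" using True by (simp add: y_def)
    have "y ^ 2 \<le> exp y"
    proof -
      have "(1 + y / 4) ^ 4 \<le> exp (y / 4) ^ 4"
        using y exp_ge_add_one_self[of "y/4"] by (intro power_mono) auto
      also have "\<dots> = exp y"
        by (simp flip: exp_of_nat_mult)
      finally have *: "(1 + y / 4) ^ 4 \<le> exp y" .
      have "y \<le> (1 + y / 4) ^ 2"
        using zero_le_power2[of "1 - y/4"] by (simp add: power2_eq_square algebra_simps)
      then have "y ^ 2 \<le> ((1 + y / 4) ^ 2) ^ 2"
        using y by (intro power_mono) auto
      also have "\<dots> = (1 + y / 4) ^ 4" by simp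
      finally show ?thesis using * by simp
    qed
    then have "y ^ 2 * exp (- y) \<le> 1"
      by (simp add: exp_minus field_simps)
    then show ?thesis
      using True by (simp add: flat_def y_def power2_eq_square abs_mult)
  qed (simp add: flat_def)
  then show ?thesis
    using field_differentiable_bound[of UNIV "flat 1" "flat [:0, 0, 1:]" 1 x y] flat_deriv[of 1]
    by auto
qed

lemma abs_mult_diff_le:
  fixes a b a' b' :: real
  assumes "\<bar>b\<bar> \<le> 1" "\<bar>a'\<bar> \<le> 1"
  shows "\<bar>a * b - a' * b'\<bar> \<le> \<bar>a - a'\<bar> + \<bar>b - b'\<bar>"
proof -
  have "\<bar>a * b - a' * b'\<bar> = \<bar>(a - a') * b + a' * (b - b')\<bar>"
    by (simp add: algebra_simps)
  also have "\<dots> \<le> \<bar>a - a'\<bar> * \<bar>b\<bar> + \<bar>a'\<bar> * \<bar>b - b'\<bar>"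
    by (metis abs_mult abs_triangle_ineq)
  also have "\<dots> \<le> \<bar>a - a'\<bar> * 1 + 1 * \<bar>b - b'\<bar>"
    using assms by (intro add_mono mult_mono) auto
  finally show ?thesis by simp
qed

locale smooth_cutoff =
  fixes \<beta> :: "real \<Rightarrow> real" and \<kappa> :: real
  assumes smooth: "Ck k \<beta>"
    and nonneg: "0 \<le> \<beta> t" and le_1: "\<beta> t \<le> 1"
    and eq_1: "\<bar>t\<bar> \<le> 1 \<Longrightarrow> \<beta> t = 1" and eq_0: "\<bar>t\<bar> \<ge> 2 \<Longrightarrow> \<beta> t = 0"
    and \<kappa>_pos: "\<kappa> > 0" and lipschitz: "\<bar>\<beta> x - \<beta> y\<bar> \<le> \<kappa> * \<bar>x - y\<bar>"

text \<open>With \<open>f = flat 1\<close> and \<open>c = f 1\<close>, the composition \<open>f (c - f t)\<close> equals \<open>f c\<close> for \<open>t \<le> 0\<close> and \<open>0\<close> for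
  \<open>t \<ge> 1\<close>, where \<open>f t \<ge> c\<close>. This gives a smooth step without dividing functions or integrating, and the Lipschitz
  bound of \<open>f\<close> passes to it. The cutoff is the product of two reflected steps.\<close>

lemma smooth_cutoff_exists: "\<exists>\<beta> \<kappa>. smooth_cutoff \<beta> \<kappa>"
proof -
  define f where "f = flat 1"
  have f: "f t = (if t > 0 then exp (- 1 / t) else 0)" for t
    by (simp add: f_def flat_def)
  have f_mono: "f x \<le> f y" if "x \<le> y" for x y
    using that by (auto simp: f frac_le)
  have f_nonneg: "0 \<le> f x" for x by (simp add: f)
  define c where "c = f 1"
  define m where "m = f c"
  have c: "c > 0" by (simp add: c_def f)
  then have m: "m > 0" by (simp add: m_def f)
  define \<psi> where "\<psi> = (\<lambda>t. f (c - f t) * (1 / m))"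
  have \<psi>_smooth: "Ck k \<psi>" for k
    unfolding \<psi>_def f_def
    by (rule Ck_mult[OF Ck_compose[OF Ck_flat Ck_diff[OF Ck_const Ck_flat]] Ck_const])
  have \<psi>_0: "\<psi> t = 0" if "t \<ge> 1" for t
    using f_mono[OF that] by (simp add: \<psi>_def c_def f[of "f 1 - _"])
  have \<psi>_1: "\<psi> t = 1" if "t \<le> 0" for t
    using that m by (simp add: \<psi>_def m_def f[of t])
  have \<psi>_nonneg: "0 \<le> \<psi> t" for t
    using f_nonneg m by (simp add: \<psi>_def)
  have \<psi>_le: "\<psi> t \<le> 1" for t
    using f_mono[of "c - f t" c] f_nonneg[of t] m by (simp add: \<psi>_def m_def)
  have \<psi>_lip: "\<bar>\<psi> x - \<psi> y\<bar> \<le> \<bar>x - y\<bar> / m" for x y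
  proof -
    have "\<bar>f (c - f x) - f (c - f y)\<bar> \<le> \<bar>x - y\<bar>"
      using flat_1_lipschitz[of "c - f x" "c - f y"] flat_1_lipschitz[of x y] by (simp add: f_def)
    moreover have "\<psi> x - \<psi> y = (f (c - f x) - f (c - f y)) / m"
      by (simp add: \<psi>_def diff_divide_distrib)
    ultimately show ?thesis using m by (simp add: divide_right_mono)
  qed
  have "smooth_cutoff (\<lambda>t. \<psi> (t - 1) * \<psi> (- t - 1)) (2 / m)"
  proof
    show "Ck k (\<lambda>t. \<psi> (t - 1) * \<psi> (- t - 1))" for k
      by (rule Ck_mult[OF Ck_compose[OF \<psi>_smooth Ck_diff[OF Ck_bounded_linear Ck_const]]
            Ck_compose[OF \<psi>_smooth Ck_diff[OF Ck_bounded_linear Ck_const]]])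
        (intro bounded_linear_ident bounded_linear_minus)+
    show "\<bar>\<psi> (x - 1) * \<psi> (- x - 1) - \<psi> (y - 1) * \<psi> (- y - 1)\<bar> \<le> 2 / m * \<bar>x - y\<bar>" for x y
    proof -
      have "\<bar>\<psi> (x - 1) * \<psi> (- x - 1) - \<psi> (y - 1) * \<psi> (- y - 1)\<bar>
          \<le> \<bar>\<psi> (x - 1) - \<psi> (y - 1)\<bar> + \<bar>\<psi> (- x - 1) - \<psi> (- y - 1)\<bar>"
        by (intro abs_mult_diff_le) (simp_all add: abs_of_nonneg \<psi>_nonneg \<psi>_le)
      also have "\<dots> \<le> \<bar>x - y\<bar> / m + \<bar>x - y\<bar> / m"
        using \<psi>_lip[of "x - 1" "y - 1"] \<psi>_lip[of "- x - 1" "- y - 1"] by (simp add: abs_minus_commute)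
      finally show ?thesis by simp
    qed
    show "\<psi> (t - 1) * \<psi> (- t - 1) = 0" if "\<bar>t\<bar> \<ge> 2" for t
    proof (cases "t \<ge> 0")
      case True
      then have "\<psi> (t - 1) = 0" using that by (intro \<psi>_0) simp
      then show ?thesis by simp
    next
      case False
      then have "\<psi> (- t - 1) = 0" using that by (intro \<psi>_0) simp
      then show ?thesis by simp
    qed
    show "\<psi> (t - 1) * \<psi> (- t - 1) = 1" if "\<bar>t\<bar> \<le> 1" for t
      using that \<psi>_1[of "t - 1"] \<psi>_1[of "- t - 1"] by simp
    show "0 \<le> \<psi> (t - 1) * \<psi> (- t - 1)" for t
      by (intro mult_nonneg_nonneg \<psi>_nonneg)
    show "\<psi> (t - 1) * \<psi> (- t - 1) \<le> 1" for t
      by (intro mult_le_one \<psi>_nonneg \<psi>_le)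
    show "2 / m > 0" using m by simp
  qed
  then show ?thesis by blast
qed

section \<open>The energy of a Lipschitz function supported in a small set\<close>

text \<open>For a function with oscillation at most \<open>1\<close> and Lipschitz constant \<open>L\<close>, this bounds the Gagliardo quotient
  at two points with difference \<open>z\<close>.\<close>

definition trunc_kernel :: "real \<Rightarrow> real \<Rightarrow> 'a::euclidean_space \<Rightarrow> real" where
  "trunc_kernel s L z = (min 1 (L * norm z))\<^sup>2 / norm z powr (real DIM('a) + 2 * s)"

lemma trunc_kernel_measurable [measurable]: "trunc_kernel s L \<in> borel_measurable borel"
  unfolding trunc_kernel_def by measurable

lemma nn_integral_lborel_reflect:
  fixes f :: "'a::euclidean_space \<Rightarrow> ennreal"
  assumes [measurable]: "f \<in> borel_measurable borel"
  shows "(\<integral>\<^sup>+ y. f (x - y) \<partial>lborel) = (\<integral>\<^sup>+ y. f y \<partial>lborel)"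
proof -
  have "(lborel :: 'a measure) = distr lborel borel (\<lambda>y. x - y)"
    using lborel_affine[of "-1" x] by (simp add: density_1)
  then have "(\<integral>\<^sup>+ y. f y \<partial>lborel) = (\<integral>\<^sup>+ y. f y \<partial>distr lborel borel (\<lambda>y. x - y))"
    by (rule arg_cong)
  also have "\<dots> = (\<integral>\<^sup>+ y. f (x - y) \<partial>lborel)"
    by (simp add: nn_integral_distr)
  finally show ?thesis ..
qed

lemma le_suminf_ennreal: "f k \<le> (\<Sum>i. f i :: ennreal)"
  using sum_le_suminf[of f "{k}"] by simp

text \<open>Decompose space into the dyadic shells \<open>r 2\<^sup>j \<le> norm z < r 2\<^sup>j\<^sup>+\<^sup>1\<close> with \<open>r = 1 / L\<close>. The shell of index \<open>j \<ge> 0\<close>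
  contributes a multiple of \<open>L powr (2 s) * 2 powr (-2 s j)\<close>, summable as \<open>s > 0\<close>; inside the
  ball of radius \<open>r\<close> the numerator \<open>(L norm z)\<^sup>2\<close> improves this to \<open>2 powr ((2 - 2 s) j)\<close>, summable over
  \<open>j < 0\<close> as \<open>s < 1\<close>. The choice of \<open>r\<close> makes the constant independent of \<open>L\<close>.\<close>

lemma nn_integral_trunc_kernel_le:
  fixes s :: real
  assumes s: "0 < s" "s < 1"
  obtains C where "0 \<le> C"
    "\<And>L. 0 < L \<Longrightarrow> (\<integral>\<^sup>+ z. trunc_kernel s L (z::'a::euclidean_space) \<partial>lborel) \<le> ennreal (C * L powr (2 * s))"
proof -
  define n where "n = real DIM('a)"
  define q where "q = n + 2 * s"
  define \<omega> where "\<omega> = unit_ball_vol n"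
  define \<rho>1 where "\<rho>1 = (2::real) powr (2 * s - 2)"
  define \<rho>2 where "\<rho>2 = (2::real) powr (- (2 * s))"
  have \<rho>: "0 < \<rho>1" "\<rho>1 < 1" "0 < \<rho>2" "\<rho>2 < 1"
    using s by (auto simp: \<rho>1_def \<rho>2_def powr_less_one)
  have n: "n > 0" by (simp add: n_def)
  have \<omega>: "\<omega> \<ge> 0" using n by (simp add: \<omega>_def)
  define C where "C = \<omega> * 2 powr q / (1 - \<rho>1) + \<omega> * 2 powr n / (1 - \<rho>2)"
  have "C \<ge> 0" using \<rho> \<omega> by (simp add: C_def)
  moreover have "(\<integral>\<^sup>+ z. trunc_kernel s L (z::'a) \<partial>lborel) \<le> ennreal (C * L powr (2 * s))"
    if L: "0 < L" for L
  proof -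
    define r where "r = 1 / L"
    have r: "r > 0" using L by (simp add: r_def)
    \<comment> \<open>\<open>a k\<close> and \<open>b k\<close> bound the kernel on the \<open>k\<close>-th shells inside and outside the ball of radius \<open>r\<close>; \<open>A k\<close> and
      \<open>B k\<close> are balls that contain these shells and have comparable measure.\<close>
    define a where "a k = 2 powr (- 2 * real k) * (r * 2 powr (- real k - 1)) powr (- q)" for k
    define b where "b k = (r * 2 powr real k) powr (- q)" for k
    define A where "A k = cball (0::'a) (r * 2 powr (- real k))" for k :: nat
    define B where "B k = cball (0::'a) (r * 2 powr (real k + 1))" for k :: nat
    have a_nonneg: "a k \<ge> 0" and b_nonneg: "b k \<ge> 0" for k
      by (auto simp: a_def b_def)
    have AB [measurable]: "A k \<in> sets borel" "B k \<in> sets borel" for k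
      by (auto simp: A_def B_def)
    have point: "ennreal (trunc_kernel s L z)
        \<le> (\<Sum>k. ennreal (a k) * indicator (A k) z) + (\<Sum>k. ennreal (b k) * indicator (B k) z)" for z :: 'a
    proof (cases "z = 0")
      case True
      then show ?thesis by (simp add: trunc_kernel_def)
    next
      case False
      then have z: "norm z > 0" by simp
      define j where "j = \<lfloor>log 2 (norm z / r)\<rfloor>"
      have lg: "2 powr (log 2 (norm z / r)) = norm z / r"
        using z r by simp
      have lo: "r * 2 powr j \<le> norm z"
      proof -
        have "2 powr real_of_int j \<le> 2 powr (log 2 (norm z / r))"
          by (simp add: j_def)
        then show ?thesis unfolding lg using r by (simp add: field_simps)
      qed
      have hi: "norm z \<le> r * 2 powr (j + 1)"
      proof -
        have "2 powr (log 2 (norm z / r)) \<le> 2 powr (real_of_int j + 1)"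
          by (simp add: j_def)
        then show ?thesis unfolding lg using r by (simp add: field_simps)
      qed
      have den: "norm z powr (- q) \<le> (r * 2 powr j) powr (- q)"
        using lo r n s by (intro powr_mono2') (auto simp: q_def)
      have ker: "trunc_kernel s L z = (min 1 (L * norm z))\<^sup>2 * norm z powr (- q)"
        unfolding trunc_kernel_def n_def[symmetric] q_def[symmetric] by (simp add: powr_minus_divide)
      have m: "0 \<le> min 1 (L * norm z)" using L by simp
      show ?thesis
      proof (cases "j \<ge> 0")
        case True
        define k where "k = nat j"
        have k: "real_of_int j = real k" using True by (simp add: k_def)
        have "(min 1 (L * norm z))\<^sup>2 \<le> 1"
          using m by (simp add: power_le_one)
        then have "trunc_kernel s L z \<le> 1 * b k"
          unfolding ker using den k by (intro mult_mono) (auto simp: b_def)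
        then have "ennreal (trunc_kernel s L z) \<le> ennreal (b k) * indicator (B k) z"
          using hi k by (simp add: B_def add.commute ennreal_leI)
        also have "\<dots> \<le> (\<Sum>k. ennreal (b k) * indicator (B k) z)"
          by (rule le_suminf_ennreal)
        finally show ?thesis by (simp add: add_increasing)
      next
        case False
        define k where "k = nat (- j - 1)"
        have k: "real_of_int j = - real k - 1" using False by (simp add: k_def)
        have "min 1 (L * norm z) \<le> 2 powr (- real k)"
          using hi k L by (simp add: r_def field_simps min.coboundedI2)
        then have "(min 1 (L * norm z))\<^sup>2 \<le> (2 powr (- real k))\<^sup>2"
          using m by (intro power_mono)
        also have "\<dots> = 2 powr (- 2 * real k)"
          by (simp add: power2_eq_square flip: powr_add)
        finally have "trunc_kernel s L z \<le> a k"
          unfolding ker a_def using den k by (intro mult_mono) auto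
        then have "ennreal (trunc_kernel s L z) \<le> ennreal (a k) * indicator (A k) z"
          using hi k by (simp add: A_def ennreal_leI)
        also have "\<dots> \<le> (\<Sum>k. ennreal (a k) * indicator (A k) z)"
          by (rule le_suminf_ennreal)
        finally show ?thesis by (simp add: add_increasing2)
      qed
    qed
    have cball: "emeasure lborel (cball (0::'a) t) = ennreal (\<omega> * t powr n)" if "t > 0" for t
      using that by (simp add: emeasure_cball \<omega>_def n_def powr_realpow)
    have rL: "r powr (- q) * r powr n = L powr (2 * s)"
    proof -
      have "r powr (- q) * r powr n = r powr (- (2 * s))"
        by (simp add: q_def flip: powr_add)
      then show ?thesis using L by (simp add: r_def powr_minus powr_divide)
    qed
    have A: "ennreal (a k) * emeasure lborel (A k) = ennreal (\<omega> * 2 powr q * L powr (2 * s) * \<rho>1 ^ k)" for k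
    proof -
      have "a k * (\<omega> * (r * 2 powr (- real k)) powr n)
          = \<omega> * (r powr (- q) * r powr n) *
            (2 powr (- 2 * real k) * 2 powr ((- real k - 1) * (- q)) * 2 powr (- real k * n))"
        unfolding a_def using r by (simp only: powr_mult powr_powr) simp
      also have "2 powr (- 2 * real k) * 2 powr ((- real k - 1) * (- q)) * 2 powr (- real k * n)
          = 2 powr q * \<rho>1 powr k"
        unfolding \<rho>1_def powr_powr powr_add[symmetric] by (simp add: q_def algebra_simps)
      finally have eq: "a k * (\<omega> * (r * 2 powr (- real k)) powr n) = \<omega> * 2 powr q * L powr (2 * s) * \<rho>1 ^ k"
        unfolding rL using \<rho> by (simp add: powr_realpow mult_ac)
      have "emeasure lborel (A k) = ennreal (\<omega> * (r * 2 powr (- real k)) powr n)"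
        unfolding A_def using r by (intro cball) simp
      then show ?thesis
        by (simp only: eq flip: ennreal_mult'[OF a_nonneg])
    qed
    have B: "ennreal (b k) * emeasure lborel (B k) = ennreal (\<omega> * 2 powr n * L powr (2 * s) * \<rho>2 ^ k)" for k
    proof -
      have "b k * (\<omega> * (r * 2 powr (real k + 1)) powr n)
          = \<omega> * (r powr (- q) * r powr n) * (2 powr (real k * (- q)) * 2 powr ((real k + 1) * n))"
        unfolding b_def using r by (simp only: powr_mult powr_powr) simp
      also have "2 powr (real k * (- q)) * 2 powr ((real k + 1) * n) = 2 powr n * \<rho>2 powr k"
        unfolding \<rho>2_def powr_powr powr_add[symmetric] by (simp add: q_def algebra_simps)
      finally have eq: "b k * (\<omega> * (r * 2 powr (real k + 1)) powr n) = \<omega> * 2 powr n * L powr (2 * s) * \<rho>2 ^ k"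
        unfolding rL using \<rho> by (simp add: powr_realpow mult_ac)
      have "emeasure lborel (B k) = ennreal (\<omega> * (r * 2 powr (real k + 1)) powr n)"
        unfolding B_def using r by (intro cball) simp
      then show ?thesis
        by (simp only: eq flip: ennreal_mult'[OF b_nonneg])
    qed
    have geom: "(\<Sum>k. ennreal (c * \<rho> ^ k)) = ennreal (c / (1 - \<rho>))" if "0 \<le> c" "0 < \<rho>" "\<rho> < 1" for c \<rho> :: real
      using that sums_mult[OF geometric_sums[of \<rho>], of c]
      by (intro suminf_ennreal_eq) auto
    have "(\<integral>\<^sup>+ z. trunc_kernel s L (z::'a) \<partial>lborel)
        \<le> (\<integral>\<^sup>+ z. (\<Sum>k. ennreal (a k) * indicator (A k) z) + (\<Sum>k. ennreal (b k) * indicator (B k) z) \<partial>lborel)"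
      by (intro nn_integral_mono point)
    also have "\<dots> = (\<Sum>k. ennreal (a k) * emeasure lborel (A k)) + (\<Sum>k. ennreal (b k) * emeasure lborel (B k))"
      by (simp add: nn_integral_add nn_integral_suminf nn_integral_cmult)
    also have "\<dots> = ennreal (\<omega> * 2 powr q * L powr (2 * s) / (1 - \<rho>1)) + ennreal (\<omega> * 2 powr n * L powr (2 * s) / (1 - \<rho>2))"
      unfolding A B using \<rho> \<omega> by (intro arg_cong2[where f = "(+)"] geom) auto
    also have "\<dots> = ennreal (C * L powr (2 * s))"
      using \<rho> \<omega> by (subst ennreal_plus[symmetric]) (auto simp: C_def distrib_right)
    finally show ?thesis .
  qed
  ultimately show thesis by (rule that)
qed

text \<open>The difference \<open>u x - u y\<close> vanishes unless \<open>x\<close> or \<open>y\<close> lies in \<open>S\<close>; integrate over the other variable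
  first. A function oscillating at scale \<open>1 / L\<close> on a set of measure \<open>m\<close> thus has energy \<open>m L powr (2 s)\<close>, up to a constant.\<close>

lemma gagliardo_le_Lipschitz:
  fixes s :: real
  assumes s: "0 < s" "s < 1"
  obtains C where "0 \<le> C"
    "\<And>(u :: 'a::euclidean_space \<Rightarrow> real) L S. 0 < L \<Longrightarrow> S \<in> sets borel \<Longrightarrow>
      (\<And>x y. \<bar>u x - u y\<bar> \<le> 1) \<Longrightarrow> (\<And>x y. \<bar>u x - u y\<bar> \<le> L * norm (x - y)) \<Longrightarrow>
      (\<And>x. x \<notin> S \<Longrightarrow> u x = 0) \<Longrightarrow>
      gagliardo s u \<le> ennreal (C * L powr (2 * s)) * emeasure lborel S"
proof -
  obtain C where C: "0 \<le> C"
    "\<And>L. 0 < L \<Longrightarrow> (\<integral>\<^sup>+ z. trunc_kernel s L (z::'a) \<partial>lborel) \<le> ennreal (C * L powr (2 * s))"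
    using nn_integral_trunc_kernel_le[OF s] by blast
  show thesis
  proof (rule that[of "2 * C"])
    fix u :: "'a \<Rightarrow> real" and L :: real and S :: "'a set"
    assume L: "0 < L" and S [measurable]: "S \<in> sets borel"
      and u1: "\<And>x y. \<bar>u x - u y\<bar> \<le> 1" and uL: "\<And>x y. \<bar>u x - u y\<bar> \<le> L * norm (x - y)"
      and uS: "\<And>x. x \<notin> S \<Longrightarrow> u x = 0"
    define K where "K = ennreal (C * L powr (2 * s))"
    define k where "k = (\<lambda>z::'a. ennreal (trunc_kernel s L z))"
    have k [measurable]: "k \<in> borel_measurable borel" by (simp add: k_def)
    have k_even: "k (x - y) = k (y - x)" for x y
      by (simp add: k_def trunc_kernel_def norm_minus_commute)
    have int_k: "(\<integral>\<^sup>+ y. k (x - y) \<partial>lborel) \<le> K" for x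
      using C(2)[OF L] nn_integral_lborel_reflect[OF k, of x] by (simp add: k_def K_def)
    have point: "ennreal ((u x - u y)\<^sup>2 / norm (x - y) powr (real DIM('a) + 2 * s))
        \<le> indicator S x * k (x - y) + indicator S y * k (y - x)" for x y
    proof (cases "x \<in> S \<or> y \<in> S")
      case True
      have "(u x - u y)\<^sup>2 \<le> (min 1 (L * norm (x - y)))\<^sup>2"
        using u1[of x y] uL[of x y] L by (intro abs_le_square_iff[THEN iffD1]) auto
      then have "ennreal ((u x - u y)\<^sup>2 / norm (x - y) powr (real DIM('a) + 2 * s)) \<le> k (x - y)"
        unfolding k_def trunc_kernel_def by (intro ennreal_leI divide_right_mono) auto
      also have "\<dots> \<le> indicator S x * k (x - y) + indicator S y * k (y - x)"
        using True k_even[of x y] by (auto simp: indicator_def)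
      finally show ?thesis .
    qed (simp add: uS)
    have "gagliardo s u \<le> (\<integral>\<^sup>+ y. \<integral>\<^sup>+ x. indicator S x * k (x - y) + indicator S y * k (y - x) \<partial>lborel \<partial>lborel)"
      unfolding gagliardo_def nn_integral_completion by (intro nn_integral_mono point)
    also have "\<dots> = (\<integral>\<^sup>+ y. \<integral>\<^sup>+ x. indicator S x * k (x - y) \<partial>lborel \<partial>lborel)
        + (\<integral>\<^sup>+ y. \<integral>\<^sup>+ x. indicator S y * k (y - x) \<partial>lborel \<partial>lborel)"
      by (simp add: nn_integral_add)
    also have "(\<integral>\<^sup>+ y. \<integral>\<^sup>+ x. indicator S x * k (x - y) \<partial>lborel \<partial>lborel)
        = (\<integral>\<^sup>+ x. \<integral>\<^sup>+ y. indicator S x * k (x - y) \<partial>lborel \<partial>lborel)"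
      by (rule lborel_pair.Fubini') measurable
    also have "(\<integral>\<^sup>+ x. \<integral>\<^sup>+ y. indicator S x * k (x - y) \<partial>lborel \<partial>lborel)
        + (\<integral>\<^sup>+ y. \<integral>\<^sup>+ x. indicator S y * k (y - x) \<partial>lborel \<partial>lborel)
        \<le> (\<integral>\<^sup>+ x. indicator S x * K \<partial>lborel) + (\<integral>\<^sup>+ x. indicator S x * K \<partial>lborel)"
      by (intro add_mono nn_integral_mono) (auto simp: nn_integral_cmult intro!: mult_left_mono int_k)
    also have "\<dots> = 2 * (emeasure lborel S * K)"
      unfolding mult_2 by (simp add: nn_integral_multc)
    also have "\<dots> = 2 * K * emeasure lborel S"
      by (simp only: mult_ac)
    also have "2 * K = ennreal (2 * C * L powr (2 * s))"
      using C by (simp add: K_def ennreal_mult' mult.assoc)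
    finally show "gagliardo s u \<le> ennreal (2 * C * L powr (2 * s)) * emeasure lborel S" .
  qed (use C in simp)
qed

text \<open>From \<open>(a - b)\<^sup>2 \<le> 2 a\<^sup>2 + 2 b\<^sup>2\<close>.\<close>

lemma gagliardo_diff_le:
  fixes u v :: "'a::euclidean_space \<Rightarrow> real"
  assumes [measurable]: "u \<in> borel_measurable borel" "v \<in> borel_measurable borel"
  shows "gagliardo s (\<lambda>x. u x - v x) \<le> 2 * gagliardo s u + 2 * gagliardo s v"
proof -
  define w where "w = (\<lambda>x y::'a. norm (x - y) powr (real DIM('a) + 2 * s))"
  have w [measurable]: "case_prod w \<in> borel_measurable (borel \<Otimes>\<^sub>M borel)"
    unfolding w_def by measurable
  have energy: "gagliardo s f = (\<integral>\<^sup>+ y. \<integral>\<^sup>+ x. ennreal ((f x - f y)\<^sup>2 / w x y) \<partial>lborel \<partial>lborel)" for f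
    by (simp add: gagliardo_def nn_integral_completion w_def)
  have w_nonneg: "0 \<le> w x y" for x y
    by (simp add: w_def)
  have point: "ennreal ((u x - v x - (u y - v y))\<^sup>2 / w x y)
      \<le> 2 * ennreal ((u x - u y)\<^sup>2 / w x y) + 2 * ennreal ((v x - v y)\<^sup>2 / w x y)" for x y
  proof -
    have "(u x - v x - (u y - v y))\<^sup>2 \<le> 2 * (u x - u y)\<^sup>2 + 2 * (v x - v y)\<^sup>2"
      using sum_squares_bound[of "u x - u y" "- (v x - v y)"] by (simp add: power2_eq_square algebra_simps)
    then have "(u x - v x - (u y - v y))\<^sup>2 / w x y \<le> (2 * (u x - u y)\<^sup>2 + 2 * (v x - v y)\<^sup>2) / w x y"
      by (intro divide_right_mono w_nonneg)
    also have "\<dots> = 2 * ((u x - u y)\<^sup>2 / w x y) + 2 * ((v x - v y)\<^sup>2 / w x y)"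
      by (simp add: add_divide_distrib)
    finally have "ennreal ((u x - v x - (u y - v y))\<^sup>2 / w x y)
       \<le> ennreal (2 * ((u x - u y)\<^sup>2 / w x y) + 2 * ((v x - v y)\<^sup>2 / w x y))"
      by (rule ennreal_leI)
    also have "\<dots> = 2 * ennreal ((u x - u y)\<^sup>2 / w x y) + 2 * ennreal ((v x - v y)\<^sup>2 / w x y)"
      by (subst ennreal_plus) (simp_all add: w_nonneg ennreal_mult' del: times_divide_eq_right)
    finally show ?thesis .
  qed
  have "gagliardo s (\<lambda>x. u x - v x) \<le> (\<integral>\<^sup>+ y. \<integral>\<^sup>+ x. 2 * ennreal ((u x - u y)\<^sup>2 / w x y)
      + 2 * ennreal ((v x - v y)\<^sup>2 / w x y) \<partial>lborel \<partial>lborel)"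
    unfolding energy by (intro nn_integral_mono point)
  also have "\<dots> = 2 * gagliardo s u + 2 * gagliardo s v"
    unfolding energy by (simp add: nn_integral_add nn_integral_cmult)
  finally show ?thesis .
qed

section \<open>Test functions as competitors for the best constant\<close>

lemma L2sq_finite:
  fixes \<phi> :: "'a::euclidean_space \<Rightarrow> real"
  assumes "\<phi> \<in> Cc_infinity \<Omega>"
  shows "L2sq UNIV \<phi> < \<infinity>"
proof -
  define K where "K = closure {x. \<phi> x \<noteq> 0}"
  have K: "compact K" and cont: "continuous_on UNIV \<phi>"
    using assms Ck.simps(1)[of \<phi>] by (auto simp: Cc_infinity_def K_def)
  have "bounded (\<phi> ` K)"
    using K cont by (intro compact_imp_bounded compact_continuous_image) (auto intro: continuous_on_subset)
  then obtain b where b: "\<And>x. x \<in> K \<Longrightarrow> \<bar>\<phi> x\<bar> \<le> b"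
    by (auto simp: bounded_iff)
  have "L2sq UNIV \<phi> \<le> (\<integral>\<^sup>+ x. ennreal (b\<^sup>2) * indicator K x \<partial>lborel)"
    unfolding L2sq_def nn_integral_completion
  proof (intro nn_integral_mono)
    fix x
    show "ennreal ((\<phi> x)\<^sup>2) * indicator UNIV x \<le> ennreal (b\<^sup>2) * indicator K x"
    proof (cases "x \<in> K")
      case True
      then show ?thesis using power_mono[OF b[OF True], of 2] by (simp add: ennreal_leI)
    next
      case False
      then have "\<phi> x = 0" using closure_subset[of "{x. \<phi> x \<noteq> 0}"] by (auto simp: K_def)
      then show ?thesis by simp
    qed
  qed
  also have "\<dots> = ennreal (b\<^sup>2) * emeasure lborel K"
    using K by (simp add: nn_integral_cmult_indicator borel_compact)
  also have "\<dots> < \<infinity>"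
    using emeasure_compact_finite[OF K] by (simp add: ennreal_mult_less_top)
  finally show ?thesis .
qed

lemma Cc_infinity_in_Hs_zero:
  fixes \<phi> :: "'a::euclidean_space \<Rightarrow> real"
  assumes "\<phi> \<in> Cc_infinity \<Omega>" and "gagliardo s \<phi> < \<infinity>"
  shows "\<phi> \<in> Hs_zero s \<Omega>"
proof -
  have "continuous_on UNIV \<phi>"
    using assms(1) Ck.simps(1)[of \<phi>] by (auto simp: Cc_infinity_def)
  then have "\<phi> \<in> borel_measurable lebesgue"
    by (intro measurable_completion) (simp add: borel_measurable_continuous_onI)
  then have "\<phi> \<in> Hs s"
    using L2sq_finite[OF assms(1)] assms(2) by (simp add: Hs_def)
  moreover have "Hs_norm s \<Omega> (\<lambda>x. \<phi> x - \<phi> x) = 0"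
    by (simp add: Hs_norm_def L2sq_def gagliardo_def)
  ultimately show ?thesis
    using assms(1) by (auto simp: Hs_zero_def intro!: bexI[of _ \<phi>])
qed

text \<open>Test functions of finite energy belong to their own closure, so they may be used as competitors; finiteness
  of the energy follows from the assumed bound.\<close>

lemma P2_eq_0I:
  fixes \<Omega> :: "'a::euclidean_space set"
  assumes "\<And>\<epsilon>. \<epsilon> > 0 \<Longrightarrow> \<exists>\<phi>\<in>Cc_infinity \<Omega>. 0 < L2sq \<Omega> \<phi> \<and> gagliardo s \<phi> \<le> ennreal \<epsilon> * L2sq \<Omega> \<phi>"
  shows "P2 s \<Omega> = 0"
proof -
  have "P2 s \<Omega> \<le> 0 + ennreal \<epsilon>" if \<epsilon>: "\<epsilon> > 0" for \<epsilon>
  proof -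
    obtain \<phi> where \<phi>: "\<phi> \<in> Cc_infinity \<Omega>" and pos: "0 < L2sq \<Omega> \<phi>"
      and le: "gagliardo s \<phi> \<le> ennreal \<epsilon> * L2sq \<Omega> \<phi>"
      using assms[OF \<epsilon>] by blast
    have "L2sq \<Omega> \<phi> \<le> L2sq UNIV \<phi>"
      unfolding L2sq_def by (intro nn_integral_mono) (auto simp: indicator_def)
    then have fin: "L2sq \<Omega> \<phi> < \<infinity>"
      using L2sq_finite[OF \<phi>] by (rule le_less_trans)
    then have "gagliardo s \<phi> < \<infinity>"
      using le_less_trans[OF le] by (simp add: ennreal_mult_less_top)
    then have "\<phi> \<in> Hs_zero s \<Omega>"
      by (rule Cc_infinity_in_Hs_zero[OF \<phi>])
    moreover have "\<not> (AE x in lebesgue. \<phi> x = 0)"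
    proof
      assume "AE x in lebesgue. \<phi> x = 0"
      then have "L2sq \<Omega> \<phi> = (\<integral>\<^sup>+ x. 0 \<partial>(lebesgue :: 'a measure))"
        unfolding L2sq_def by (intro nn_integral_cong_AE) auto
      then show False using pos by simp
    qed
    ultimately have "P2 s \<Omega> \<le> gagliardo s \<phi> / L2sq \<Omega> \<phi>"
      unfolding P2_def by (intro INF_lower) auto
    also have "\<dots> \<le> ennreal \<epsilon>"
      using pos le by (intro divide_le_posI_ennreal) (auto simp: mult.commute)
    finally show ?thesis by simp
  qed
  then have "P2 s \<Omega> \<le> 0"
    by (rule ennreal_le_epsilon)
  then show ?thesis by simp
qed

section \<open>The comb domain\<close>

text \<open>The factor \<open>1 + x\<^sup>2\<close> makes the tooth at a zero \<open>k \<pi>\<close> of the sine have width of order \<open>1 / \<bar>k\<bar>\<close>. Near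
  \<open>x = 0\<close> the tooth is wide, which is harmless.\<close>

definition comb :: "(real ^ 2) set" where
  "comb = {p. -1 < p $ 2 \<and> (p $ 2 < 0 \<or> 1 < (1 + (p $ 1)\<^sup>2) * (sin (p $ 1))\<^sup>2)}"

lemma open_comb: "open comb"
  unfolding comb_def
  by (intro open_Collect_conj open_Collect_disj open_Collect_less continuous_intros)

text \<open>Project vertically to the line \<open>y = -1/2\<close>, then contract that line. The vertical segments stay in
  the comb because the condition on \<open>x\<close> is the same at every height.\<close>

lemma contractible_comb: "contractible comb"
proof -
  define f :: "real ^ 2 \<Rightarrow> real ^ 2" where "f = (\<lambda>p. \<chi> i. if i = 1 then p $ 1 else - 1 / 2)"
  define o' :: "real ^ 2" where "o' = (\<chi> i. if i = 1 then 0 else - 1 / 2)"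
  have f: "f p $ 1 = p $ 1" "f p $ 2 = - 1 / 2" for p by (auto simp: f_def)
  have o': "o' $ 1 = 0" "o' $ 2 = - 1 / 2" by (auto simp: o'_def)
  have cont: "continuous_on comb f"
    unfolding f_def
  proof (rule continuous_on_vec_lambda)
    show "continuous_on comb (\<lambda>p. if i = 1 then p $ 1 else - 1 / 2)" for i :: 2
      by (cases "i = 1") (auto intro!: continuous_intros)
  qed
  have "homotopic_with_canon (\<lambda>_. True) comb comb id f"
  proof (rule homotopic_with_linear)
    fix p assume p: "p \<in> comb"
    show "closed_segment (id p) (f p) \<subseteq> comb"
    proof
      fix z assume "z \<in> closed_segment (id p) (f p)"
      then obtain t where t: "0 \<le> t" "t \<le> 1" "z = (1 - t) *\<^sub>R p + t *\<^sub>R f p"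
        by (auto simp: in_segment)
      have "z $ 1 = (1 - t) * p $ 1 + t * p $ 1" using t f[of p] by simp
      then have z1: "z $ 1 = p $ 1" by (simp add: algebra_simps)
      have z2: "z $ 2 = (1 - t) * p $ 2 + t * (- 1 / 2)" using t f[of p] by simp
      have "-1 < z $ 2"
        unfolding z2 using t p convex_bound_lt[of "- p $ 2" 1 "1 / 2" "1 - t" t]
        by (auto simp: comb_def algebra_simps)
      moreover have "z $ 2 < 0" if "p $ 2 < 0"
        unfolding z2 using t that by (intro convex_bound_lt) auto
      ultimately show "z \<in> comb"
        using p z1 by (auto simp: comb_def)
    qed
  qed (auto intro: cont continuous_on_id)
  moreover have "homotopic_with_canon (\<lambda>_. True) comb comb f (\<lambda>_. o')"
  proof (rule homotopic_with_linear)
    fix p assume p: "p \<in> comb"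
    show "closed_segment (f p) o' \<subseteq> comb"
    proof
      fix z assume "z \<in> closed_segment (f p) o'"
      then obtain t where t: "z = (1 - t) *\<^sub>R f p + t *\<^sub>R o'"
        by (auto simp: in_segment)
      have "z $ 2 = (1 - t) * (- 1 / 2) + t * (- 1 / 2)" using t f[of p] o' by simp
      then have "z $ 2 = - 1 / 2" by (simp add: field_simps)
      then show "z \<in> comb" by (simp add: comb_def)
    qed
  qed (auto intro: cont)
  ultimately show ?thesis
    unfolding contractible_def using homotopic_with_trans by blast
qed

text \<open>From a point of the comb, moving to the nearest zero of the sine to the left and up by \<open>2\<close>, hence by less than \<open>10\<close> in total, leads
  into the interior of a tooth. So a larger ball meets the complement in a set with interior points.\<close>

lemma BC_comb_le: "BC comb \<le> 10"
  unfolding BC_def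
proof (rule Sup_least, safe)
  fix r x assume r: "0 < r" and x: "x \<in> comb" and null: "emeasure lebesgue (ball x r \<inter> - comb) = 0"
  \<comment> \<open>An open part of the complement, which meets every tooth.\<close>
  define V :: "(real ^ 2) set" where "V = {p. 0 < p $ 2 \<and> (1 + (p $ 1)\<^sup>2) * (sin (p $ 1))\<^sup>2 < 1}"
  have V: "open V"
    unfolding V_def by (intro open_Collect_conj open_Collect_less continuous_intros)
  show "ennreal r \<le> 10"
  proof (rule ccontr)
    assume "\<not> ennreal r \<le> 10"
    then have r10: "r > 10"
      using ennreal_leI[of r 10] by force
    define k where "k = \<lfloor>x $ 1 / pi\<rfloor>"
    define p :: "real ^ 2" where "p = (\<chi> i. if i = 1 then real_of_int k * pi else x $ 2 + 2)"
    have p: "p $ 1 = real_of_int k * pi" "p $ 2 = x $ 2 + 2" by (auto simp: p_def)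
    have "sin (real_of_int k * pi) = 0" using sin_zero_iff_int2 by blast
    then have "p \<in> V" using x by (auto simp: V_def p comb_def)
    moreover have "p \<in> ball x r"
    proof -
      have "real_of_int k \<le> x $ 1 / pi" "x $ 1 / pi < real_of_int k + 1"
        unfolding k_def by linarith+
      then have "real_of_int k * pi \<le> x $ 1" "x $ 1 < real_of_int k * pi + pi"
        by (simp_all add: field_simps)
      then have "\<bar>(x - p) $ 1\<bar> \<le> pi" "\<bar>(x - p) $ 2\<bar> \<le> 2" by (auto simp: p)
      then have "norm (x - p) \<le> pi + 2"
        using norm_le_l1_cart[of "x - p"] by (simp add: UNIV_2)
      then show ?thesis using r10 pi_less_4 by (simp add: dist_norm)
    qed
    ultimately have "ball x r \<inter> V \<noteq> {}" by blast
    then have "\<not> negligible (ball x r \<inter> V)"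
      using V by (intro open_not_negligible) auto
    moreover have "negligible (ball x r \<inter> V)"
    proof (rule negligible_subset)
      have "open comb" by (rule open_comb)
      then have "ball x r \<inter> - comb \<in> sets lebesgue" by (auto intro: borel_open)
      then show "negligible (ball x r \<inter> - comb)"
        using null by (simp add: negligible_iff_null_sets null_setsI)
      show "ball x r \<inter> V \<subseteq> ball x r \<inter> - comb" by (auto simp: V_def comb_def)
    qed
    ultimately show False by blast
  qed
qed

section \<open>Measure of the neighbourhood of the teeth\<close>

text \<open>Up to \<open>\<pi> / 3\<close> the slope of the sine is at least \<open>1 / 2\<close>; beyond, \<open>sin t \<ge> sqrt 3 / 2 > \<pi> / 4 \<ge> t / 2\<close>.\<close>

lemma abs_sin_ge_half:
  fixes t :: real
  assumes "\<bar>t\<bar> \<le> pi / 2"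
  shows "\<bar>t\<bar> / 2 \<le> \<bar>sin t\<bar>"
proof -
  have *: "t / 2 \<le> sin t" if t: "0 \<le> t" "t \<le> pi / 2" for t :: real
  proof (cases "t \<le> pi / 3")
    case True
    have "sin 0 - 0 / 2 \<le> sin t - t / 2"
    proof (rule DERIV_nonneg_imp_nondecreasing[OF t(1)])
      fix x assume "0 \<le> x" "x \<le> t"
      then have "cos (pi / 3) \<le> cos x" using True by (intro cos_monotone_0_pi_le) auto
      then have "0 \<le> cos x - 1 / 2" by (simp add: cos_60)
      moreover have "((\<lambda>x. sin x - x / 2) has_real_derivative cos x - 1 / 2) (at x)"
        by (auto intro!: derivative_eq_intros)
      ultimately show "\<exists>y. ((\<lambda>x. sin x - x / 2) has_real_derivative y) (at x) \<and> 0 \<le> y"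
        by blast
    qed
    then show ?thesis by simp
  next
    case False
    then have "sin (pi / 3) \<le> sin t" using t by (intro sin_monotone_2pi_le) auto
    moreover have "8 / 5 \<le> sqrt 3"
      by (rule real_le_rsqrt) (simp add: power2_eq_square)
    moreover have "pi < 16 / 5" using pi_approx by simp
    ultimately show ?thesis using t by (simp add: sin_60)
  qed
  from *[of t] *[of "- t"] assms show ?thesis by (cases "t \<ge> 0") auto
qed

lemma emeasure_rectangle:
  assumes "0 \<le> a" "0 \<le> b"
  shows "emeasure lborel {p :: real ^ 2. \<bar>p $ 1 - x\<bar> \<le> a \<and> \<bar>p $ 2 - y\<bar> \<le> b} = ennreal (4 * a * b)"
proof -
  define l :: "real ^ 2" where "l = vector [x - a, y - b]"
  define u :: "real ^ 2" where "u = vector [x + a, y + b]"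
  have eq: "{p :: real ^ 2. \<bar>p $ 1 - x\<bar> \<le> a \<and> \<bar>p $ 2 - y\<bar> \<le> b} = cbox l u"
    by (auto simp: l_def u_def mem_box_cart forall_2 abs_le_iff)
  have "l \<in> cbox l u"
    using assms by (auto simp: l_def u_def mem_box_cart forall_2)
  then have "measure lborel (cbox l u) = 4 * a * b"
    by (subst content_cbox_cart) (auto simp: l_def u_def UNIV_2)
  moreover have "emeasure lborel (cbox l u) = ennreal (measure lborel (cbox l u))"
    using emeasure_lborel_cbox_finite[of l u] by (intro emeasure_eq_ennreal_measure) simp
  ultimately show ?thesis by (simp add: eq)
qed

lemma closed_rectangle: "closed {p :: real ^ 2. \<bar>p $ 1 - x\<bar> \<le> a \<and> \<bar>p $ 2 - y\<bar> \<le> b}"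
  by (intro closed_Collect_conj closed_Collect_le continuous_intros)

text \<open>The sine is small only near its zeros: reduce to \<open>\<bar>t\<bar> \<le> \<pi> / 2\<close> by periodicity.\<close>

lemma near_multiple_of_pi:
  assumes "\<bar>sin x\<bar> \<le> \<eta>"
  shows "\<bar>x - real_of_int (round (x / pi)) * pi\<bar> \<le> min (2 * \<eta>) (pi / 2)"
proof -
  define k where "k = round (x / pi)"
  define t where "t = x - real_of_int k * pi"
  have "\<bar>real_of_int k - x / pi\<bar> * pi \<le> 1 / 2 * pi"
    unfolding k_def by (intro mult_right_mono of_int_round_abs_le) simp
  moreover have "\<bar>real_of_int k - x / pi\<bar> * pi = \<bar>(real_of_int k - x / pi) * pi\<bar>"
    by (simp add: abs_mult)
  moreover have "(real_of_int k - x / pi) * pi = - t"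
    by (simp add: t_def field_simps)
  ultimately have t: "\<bar>t\<bar> \<le> pi / 2" by simp
  have s0: "sin (real_of_int k * pi) = 0" using sin_zero_iff_int2 by blast
  then have "\<bar>cos (real_of_int k * pi)\<bar> = 1"
    using sin_cos_squared_add[of "real_of_int k * pi"] by (simp add: power2_eq_1_iff) auto
  then have "\<bar>sin t\<bar> = \<bar>sin x\<bar>"
    using s0 by (simp add: t_def sin_diff abs_mult)
  then show ?thesis
    using abs_sin_ge_half[OF t] t assms by (simp add: t_def k_def)
qed

lemma abs_sin_diff_le: "\<bar>sin x - sin y\<bar> \<le> \<bar>x - y :: real\<bar>"
  using field_differentiable_bound[of UNIV sin cos 1 x y] by (auto intro: DERIV_sin)

text \<open>The centre has abscissa \<open>n \<pi> \<ge> 3 n\<close> and height \<open>2 n\<close>, so that the square of half-side \<open>2 n\<close> lies in \<open>x \<ge> n\<close>,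
  where the teeth have width of order \<open>1 / n\<close>, and in \<open>y \<ge> 0\<close>.\<close>

definition window :: "nat \<Rightarrow> real \<Rightarrow> (real ^ 2) set" where
  "window n a = {p. \<bar>p $ 1 - real n * pi\<bar> \<le> a \<and> \<bar>p $ 2 - 2 * real n\<bar> \<le> a}"

text \<open>The factor \<open>2\<close> is the radius off which the cutoff \<open>\<beta> (n sin x)\<close> vanishes; the teeth themselves
  satisfy \<open>n \<bar>sin x\<bar> \<le> 1\<close> in the window.\<close>

definition tooth_zone :: "nat \<Rightarrow> (real ^ 2) set" where
  "tooth_zone n = window n (2 * real n) \<inter> {p. \<bar>sin (p $ 1)\<bar> \<le> 2 / real n}"

lemma closed_window: "closed (window n a)"
  unfolding window_def by (rule closed_rectangle)

lemma closed_tooth_zone: "closed (tooth_zone n)"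
  unfolding tooth_zone_def by (intro closed_Int closed_window closed_Collect_le continuous_intros)

lemma emeasure_window: "0 \<le> a \<Longrightarrow> emeasure lborel (window n a) = ennreal (4 * a\<^sup>2)"
  unfolding window_def by (subst emeasure_rectangle) (auto simp: power2_eq_square)

text \<open>The zone is covered by strips of half-width \<open>4 / n\<close> and height \<open>4 n\<close>, each of area \<open>32\<close>, around the
  \<open>2 n + 3\<close> zeros \<open>k \<pi>\<close> of the sine with \<open>\<bar>k - n\<bar> \<le> n + 1\<close>.\<close>

lemma emeasure_tooth_zone_le:
  assumes n: "n \<ge> 1"
  shows "emeasure lborel (tooth_zone n) \<le> ennreal (160 * real n)"
proof -
  define S where "S k = {p :: real ^ 2. \<bar>p $ 1 - real_of_int k * pi\<bar> \<le> 4 / real n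
    \<and> \<bar>p $ 2 - 2 * real n\<bar> \<le> 2 * real n}" for k
  have S_closed: "closed (S k)" for k
    unfolding S_def by (rule closed_rectangle)
  have S_meas: "emeasure lborel (S k) = ennreal 32" for k
    unfolding S_def using n by (subst emeasure_rectangle) auto
  have "tooth_zone n \<subseteq> (\<Union>k\<in>{-1..2 * int n + 1}. S k)"
  proof
    fix p assume p: "p \<in> tooth_zone n"
    define k where "k = round (p $ 1 / pi)"
    have near: "\<bar>p $ 1 - real_of_int k * pi\<bar> \<le> 4 / real n" "\<bar>p $ 1 - real_of_int k * pi\<bar> \<le> pi / 2"
      using near_multiple_of_pi[of "p $ 1" "2 / real n"] p by (auto simp: k_def tooth_zone_def)
    have "\<bar>real_of_int k - real n\<bar> * 3 \<le> \<bar>real_of_int k - real n\<bar> * pi"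
      using pi_gt3 by (intro mult_left_mono) auto
    also have "\<dots> = \<bar>real_of_int k * pi - real n * pi\<bar>"
      by (simp add: abs_mult flip: left_diff_distrib)
    also have "\<dots> \<le> pi / 2 + 2 * real n"
    proof -
      have "\<bar>p $ 1 - real n * pi\<bar> \<le> 2 * real n"
        using p by (simp add: tooth_zone_def window_def)
      then show ?thesis using near(2) by linarith
    qed
    finally have "\<bar>real_of_int k - real n\<bar> * 3 \<le> pi / 2 + 2 * real n" .
    then have "\<bar>real_of_int k - real n\<bar> \<le> real n + 1"
    proof -
      have "0 \<le> real n" by simp
      then show ?thesis using pi_less_4 \<open>\<bar>real_of_int k - real n\<bar> * 3 \<le> pi / 2 + 2 * real n\<close> by argo
    qed
    then have "k \<in> {-1..2 * int n + 1}" by (simp add: abs_le_iff)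
    moreover have "p \<in> S k"
      using near p by (auto simp: S_def tooth_zone_def window_def)
    ultimately show "p \<in> (\<Union>k\<in>{-1..2 * int n + 1}. S k)" by blast
  qed
  then have "emeasure lborel (tooth_zone n) \<le> emeasure lborel (\<Union>k\<in>{-1..2 * int n + 1}. S k)"
    using S_closed by (intro emeasure_mono) auto
  also have "\<dots> \<le> (\<Sum>k\<in>{-1..2 * int n + 1}. emeasure lborel (S k))"
    using S_closed by (intro emeasure_subadditive_finite) auto
  also have "\<dots> = of_nat (2 * n + 3) * ennreal 32"
  proof -
    have "card {-1..2 * int n + 1} = 2 * n + 3"
      by (simp add: nat_eq_iff)
    then show ?thesis by (simp only: S_meas sum_constant)
  qed
  also have "\<dots> = ennreal (real (2 * n + 3) * 32)"
    by (simp only: ennreal_of_nat_eq_real_of_nat flip: ennreal_mult'[OF of_nat_0_le_iff])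
  also have "\<dots> \<le> ennreal (160 * real n)"
    using n by (intro ennreal_leI) simp
  finally show ?thesis .
qed

section \<open>Competitors with small Rayleigh quotient\<close>

context smooth_cutoff
begin

definition bump :: "nat \<Rightarrow> real ^ 2 \<Rightarrow> real" where
  "bump n p = \<beta> (1 / real n * (p $ 1 - real n * pi)) * \<beta> (1 / real n * (p $ 2 - 2 * real n))"

definition tooth_bump :: "nat \<Rightarrow> real ^ 2 \<Rightarrow> real" where
  "tooth_bump n p = bump n p * \<beta> (real n * sin (p $ 1))"

text \<open>It equals \<open>bump n p * (1 - \<beta> (n sin x))\<close> and hence vanishes where \<open>n \<bar>sin x\<bar> \<le> 1\<close>, in particular on the teeth in
  the window. The form as a difference separates the two scales in the energy estimate.\<close>

definition test_fun :: "nat \<Rightarrow> real ^ 2 \<Rightarrow> real" where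
  "test_fun n p = bump n p - tooth_bump n p"

lemma Ck_bump: "Ck k (bump n)"
proof -
  have "Ck k (\<lambda>p :: real ^ 2. 1 / real n * (p $ i - c))" for c i
    by (rule Ck_mult[OF Ck_const Ck_diff[OF Ck_bounded_linear[OF bounded_linear_vec_nth] Ck_const]])
  then show ?thesis
    unfolding bump_def by (intro Ck_mult[OF Ck_compose[OF smooth] Ck_compose[OF smooth]])
qed

lemma Ck_tooth_bump: "Ck k (tooth_bump n)"
proof -
  have "Ck k (\<lambda>p :: real ^ 2. real n * sin (p $ 1))"
    by (rule Ck_mult[OF Ck_const Ck_compose[OF Ck_sin Ck_bounded_linear[OF bounded_linear_vec_nth]]])
  then show ?thesis
    unfolding tooth_bump_def by (intro Ck_mult[OF Ck_bump Ck_compose[OF smooth]])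
qed

lemma bump_range: "0 \<le> bump n p" "bump n p \<le> 1"
  by (simp_all add: bump_def nonneg le_1 mult_le_one)

lemma tooth_bump_range: "0 \<le> tooth_bump n p" "tooth_bump n p \<le> 1"
  by (simp_all add: tooth_bump_def bump_range nonneg le_1 mult_le_one)

lemma bump_outside:
  assumes n: "n \<ge> 1" and p: "p \<notin> window n (2 * real n)"
  shows "bump n p = 0"
proof -
  have *: "\<beta> (1 / real n * t) = 0" if "\<bar>t\<bar> > 2 * real n" for t
    using that n by (intro eq_0) (simp add: field_simps)
  show ?thesis
    using p *[of "p $ 1 - real n * pi"] *[of "p $ 2 - 2 * real n"] by (auto simp: window_def bump_def)
qed

lemma tooth_bump_outside:
  assumes n: "n \<ge> 1" and p: "p \<notin> tooth_zone n"
  shows "tooth_bump n p = 0"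
proof (cases "p \<in> window n (2 * real n)")
  case True
  then have "\<bar>real n * sin (p $ 1)\<bar> \<ge> 2"
    using n p by (auto simp: tooth_zone_def abs_mult field_simps)
  then show ?thesis by (simp add: tooth_bump_def eq_0)
qed (simp add: tooth_bump_def bump_outside[OF n])

lemma bump_lipschitz:
  assumes n: "n \<ge> 1"
  shows "\<bar>bump n p - bump n q\<bar> \<le> 2 * \<kappa> / real n * norm (p - q)"
proof -
  have "\<bar>\<beta> (1 / real n * (p $ i - c)) - \<beta> (1 / real n * (q $ i - c))\<bar> \<le> \<kappa> / real n * norm (p - q)" for i c
  proof -
    have "\<bar>\<beta> (1 / real n * (p $ i - c)) - \<beta> (1 / real n * (q $ i - c))\<bar>
        \<le> \<kappa> * \<bar>1 / real n * (p $ i - c) - 1 / real n * (q $ i - c)\<bar>"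
      by (rule lipschitz)
    also have "1 / real n * (p $ i - c) - 1 / real n * (q $ i - c) = (p - q) $ i / real n"
      by (simp add: diff_divide_distrib)
    also have "\<kappa> * \<bar>(p - q) $ i / real n\<bar> = \<kappa> / real n * \<bar>(p - q) $ i\<bar>"
      by simp
    also have "\<dots> \<le> \<kappa> / real n * norm (p - q)"
      using \<kappa>_pos by (intro mult_left_mono component_le_norm_cart) auto
    finally show ?thesis .
  qed
  note comp = this
  have "\<bar>bump n p - bump n q\<bar> \<le> \<kappa> / real n * norm (p - q) + \<kappa> / real n * norm (p - q)"
    unfolding bump_def
    by (rule order.trans[OF abs_mult_diff_le add_mono[OF comp comp]]) (simp_all add: nonneg le_1)
  then show ?thesis by simp
qed

text \<open>The cutoff around the teeth varies at scale \<open>1 / n\<close> because its argument is \<open>n sin x\<close>; the variation of \<open>bump\<close>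
  is slower and is absorbed.\<close>

lemma tooth_bump_lipschitz:
  assumes n: "n \<ge> 1"
  shows "\<bar>tooth_bump n p - tooth_bump n q\<bar> \<le> 3 * \<kappa> * real n * norm (p - q)"
proof -
  have "\<bar>\<beta> (real n * sin (p $ 1)) - \<beta> (real n * sin (q $ 1))\<bar> \<le> \<kappa> * \<bar>real n * sin (p $ 1) - real n * sin (q $ 1)\<bar>"
    by (rule lipschitz)
  also have "\<dots> = \<kappa> * real n * \<bar>sin (p $ 1) - sin (q $ 1)\<bar>"
    by (simp add: abs_mult flip: right_diff_distrib)
  also have "\<dots> \<le> \<kappa> * real n * norm (p - q)"
    using \<kappa>_pos abs_sin_diff_le[of "p $ 1" "q $ 1"] component_le_norm_cart[of "p - q" 1]
    by (intro mult_left_mono) auto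
  finally have sin: "\<bar>\<beta> (real n * sin (p $ 1)) - \<beta> (real n * sin (q $ 1))\<bar> \<le> \<kappa> * real n * norm (p - q)" .
  have "2 * \<kappa> / real n \<le> 2 * \<kappa> * real n"
  proof -
    have "1 / real n \<le> 1" using n by simp
    also have "1 \<le> real n" using n by simp
    finally have "2 * \<kappa> * (1 / real n) \<le> 2 * \<kappa> * real n"
      using \<kappa>_pos by (intro mult_left_mono) auto
    then show ?thesis by simp
  qed
  then have bump: "\<bar>bump n p - bump n q\<bar> \<le> 2 * \<kappa> * real n * norm (p - q)"
    using bump_lipschitz[OF n, of p q] by (meson mult_right_mono norm_ge_zero order.trans)
  have "\<bar>tooth_bump n p - tooth_bump n q\<bar> \<le> 2 * \<kappa> * real n * norm (p - q) + \<kappa> * real n * norm (p - q)"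
    unfolding tooth_bump_def
    by (rule order.trans[OF abs_mult_diff_le add_mono[OF bump sin]]) (simp_all add: nonneg le_1 bump_range)
  then show ?thesis by (simp add: algebra_simps)
qed

text \<open>Where the function does not vanish, \<open>n\<^sup>2 sin\<^sup>2 x \<ge> 1\<close> and \<open>x \<ge> n\<close>, hence \<open>(1 + x\<^sup>2) sin\<^sup>2 x > 1\<close>. The two
  former conditions are closed, so they also hold on the support.\<close>

lemma test_fun_in_Cc_infinity:
  assumes n: "n \<ge> 1"
  shows "test_fun n \<in> Cc_infinity comb"
proof -
  define K where "K = window n (2 * real n) \<inter> {p. 1 \<le> \<bar>real n * sin (p $ 1)\<bar>}"
  have "closed K"
    unfolding K_def by (intro closed_Int closed_window closed_Collect_le continuous_intros)
  moreover have "{p. test_fun n p \<noteq> 0} \<subseteq> K"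
  proof -
    have "p \<in> K" if "test_fun n p \<noteq> 0" for p
    proof -
      have eq: "test_fun n p = bump n p * (1 - \<beta> (real n * sin (p $ 1)))"
        by (simp add: test_fun_def tooth_bump_def algebra_simps)
      then have "p \<in> window n (2 * real n)"
        using that bump_outside[OF n, of p] by force
      moreover have "1 \<le> \<bar>real n * sin (p $ 1)\<bar>"
        using that eq eq_1[of "real n * sin (p $ 1)"] by force
      ultimately show ?thesis by (simp add: K_def)
    qed
    then show ?thesis by blast
  qed
  ultimately have supp: "closure {p. test_fun n p \<noteq> 0} \<subseteq> K"
    by (rule closure_minimal[rotated])
  have "K \<subseteq> comb"
  proof
    fix p assume p: "p \<in> K"
    have sin1: "1 \<le> (real n * sin (p $ 1))\<^sup>2"
      using p by (simp add: K_def abs_le_square_iff[of 1, simplified])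
    have "real n * 3 \<le> real n * pi" using pi_gt3 by (intro mult_left_mono) auto
    then have "real n \<le> p $ 1" using p by (auto simp: K_def window_def)
    then have "(real n)\<^sup>2 \<le> (p $ 1)\<^sup>2" by (intro power_mono) auto
    moreover have "(sin (p $ 1))\<^sup>2 > 0" using sin1 by auto
    ultimately have "(real n)\<^sup>2 * (sin (p $ 1))\<^sup>2 < (1 + (p $ 1)\<^sup>2) * (sin (p $ 1))\<^sup>2"
      by (intro mult_strict_right_mono) auto
    then have "1 < (1 + (p $ 1)\<^sup>2) * (sin (p $ 1))\<^sup>2"
      using sin1 by (simp add: power_mult_distrib)
    then show "p \<in> comb" using p by (auto simp: K_def window_def comb_def)
  qed
  moreover have "bounded (window n (2 * real n))"
  proof (rule boundedI)
    fix p assume p: "p \<in> window n (2 * real n)"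
    have "norm p \<le> \<bar>p $ 1\<bar> + \<bar>p $ 2\<bar>"
      using norm_le_l1_cart[of p] by (simp add: UNIV_2)
    moreover have "\<bar>p $ 1 - real n * pi\<bar> \<le> 2 * real n" "\<bar>p $ 2 - 2 * real n\<bar> \<le> 2 * real n"
      using p by (auto simp: window_def)
    moreover have "0 \<le> real n * pi" by simp
    ultimately show "norm p \<le> (real n * pi + 2 * real n) + (2 * real n + 2 * real n)"
      by linarith
  qed
  then have "bounded (closure {p. test_fun n p \<noteq> 0})"
    by (rule bounded_subset) (use supp in \<open>auto simp: K_def\<close>)
  moreover have "Ck k (test_fun n)" for k
    unfolding test_fun_def by (rule Ck_diff[OF Ck_bump Ck_tooth_bump])
  ultimately show ?thesis
    using supp by (auto simp: Cc_infinity_def compact_eq_bounded_closed)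
qed

text \<open>The function equals \<open>1\<close> on the inner square of area \<open>4 n\<^sup>2\<close> minus the tooth zone, whose area \<open>160 n\<close> is
  at most half of that if \<open>n \<ge> 80\<close>.\<close>

lemma L2sq_test_fun_ge:
  assumes n: "n \<ge> 80"
  shows "ennreal (2 * (real n)\<^sup>2) \<le> L2sq comb (test_fun n)"
proof -
  define W where "W = window n (real n) - tooth_zone n"
  define E where "E = emeasure lborel W"
  have W_sets [measurable]: "W \<in> sets borel"
    unfolding W_def using closed_window closed_tooth_zone by auto
  have one: "test_fun n p = 1" if "p \<in> W" for p
  proof -
    have *: "\<beta> (1 / real n * t) = 1" if "\<bar>t\<bar> \<le> real n" for t
      using that n by (intro eq_1) (simp add: field_simps)
    have "bump n p = 1"
      using that *[of "p $ 1 - real n * pi"] *[of "p $ 2 - 2 * real n"]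
      by (simp add: W_def window_def bump_def)
    moreover have "tooth_bump n p = 0"
      using that n by (intro tooth_bump_outside) (auto simp: W_def)
    ultimately show ?thesis by (simp add: test_fun_def)
  qed
  have W_comb: "W \<subseteq> comb"
  proof
    fix p assume "p \<in> W"
    then have "p \<in> closure {p. test_fun n p \<noteq> 0}"
      using one[of p] by (intro closure_subset[THEN subsetD]) simp
    then show "p \<in> comb"
      using test_fun_in_Cc_infinity[of n] n by (auto simp: Cc_infinity_def)
  qed
  have "ennreal (4 * (real n)\<^sup>2) = emeasure lborel (window n (real n))"
    by (simp add: emeasure_window)
  also have "\<dots> \<le> emeasure lborel (W \<union> tooth_zone n)"
    using closed_tooth_zone by (intro emeasure_mono) (auto simp: W_def closed_window)
  also have "\<dots> \<le> E + emeasure lborel (tooth_zone n)"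
    unfolding E_def using closed_tooth_zone by (intro emeasure_subadditive) auto
  also have "\<dots> \<le> E + ennreal (2 * (real n)\<^sup>2)"
  proof (intro add_left_mono order.trans[OF emeasure_tooth_zone_le] ennreal_leI)
    show "160 * real n \<le> 2 * (real n)\<^sup>2"
      using n mult_right_mono[of 80 "real n" "real n"] by (simp add: power2_eq_square)
  qed (use n in simp)
  finally have "ennreal (4 * (real n)\<^sup>2) \<le> E + ennreal (2 * (real n)\<^sup>2)" .
  then have "ennreal (2 * (real n)\<^sup>2) \<le> E"
  proof (cases E)
    case (real e)
    assume "ennreal (4 * (real n)\<^sup>2) \<le> E + ennreal (2 * (real n)\<^sup>2)"
    then have "ennreal (4 * (real n)\<^sup>2) \<le> ennreal (e + 2 * (real n)\<^sup>2)"
      using real by simp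
    then have "4 * (real n)\<^sup>2 \<le> e + 2 * (real n)\<^sup>2"
      using real by (subst (asm) ennreal_le_iff) auto
    then show ?thesis using real by (simp add: ennreal_leI)
  qed simp
  also have "E = (\<integral>\<^sup>+ p. indicator W p \<partial>lborel)"
    by (simp add: E_def)
  also have "\<dots> \<le> L2sq comb (test_fun n)"
    unfolding L2sq_def nn_integral_completion
    using W_comb by (intro nn_integral_mono) (auto simp: indicator_def one)
  finally show ?thesis .
qed

text \<open>The terms come from \<open>bump\<close> (measure \<open>16 n\<^sup>2\<close>, Lipschitz constant \<open>2 \<kappa> / n\<close>) and \<open>tooth_bump\<close>
  (measure at most \<open>160 n\<close>, Lipschitz constant \<open>3 \<kappa> n\<close>).\<close>

lemma test_fun_energy:
  assumes "0 < s" "s < 1"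
  obtains A B where "\<And>n. n \<ge> 1 \<Longrightarrow> gagliardo s (test_fun n)
    \<le> ennreal (A * real n powr (2 - 2 * s) + B * real n powr (1 + 2 * s))"
proof -
  show thesis
  proof (rule gagliardo_le_Lipschitz[OF assms, where 'a = "real ^ 2"])
    fix C :: real
    assume C: "0 \<le> C"
      "\<And>(u :: real ^ 2 \<Rightarrow> real) L S. 0 < L \<Longrightarrow> S \<in> sets borel \<Longrightarrow>
        (\<And>x y. \<bar>u x - u y\<bar> \<le> 1) \<Longrightarrow> (\<And>x y. \<bar>u x - u y\<bar> \<le> L * norm (x - y)) \<Longrightarrow>
        (\<And>x. x \<notin> S \<Longrightarrow> u x = 0) \<Longrightarrow>
        gagliardo s u \<le> ennreal (C * L powr (2 * s)) * emeasure lborel S"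
    show thesis
    proof (rule that)
    fix n :: nat assume n: "n \<ge> 1"
    have osc: "\<bar>a - b\<bar> \<le> 1" if "0 \<le> a" "a \<le> 1" "0 \<le> b" "b \<le> 1" for a b :: real
      using that by linarith
    have "gagliardo s (bump n) \<le> ennreal (C * (2 * \<kappa> / real n) powr (2 * s)) * emeasure lborel (window n (2 * real n))"
      using n \<kappa>_pos closed_window
      by (intro C(2) bump_lipschitz bump_outside osc bump_range) auto
    also have "\<dots> = ennreal (C * (2 * \<kappa> / real n) powr (2 * s) * (16 * (real n)\<^sup>2))"
      using C(1) by (subst emeasure_window) (auto simp: ennreal_mult' power_mult_distrib)
    also have "C * (2 * \<kappa> / real n) powr (2 * s) * (16 * (real n)\<^sup>2)
        = 16 * C * (2 * \<kappa>) powr (2 * s) * real n powr (2 - 2 * s)"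
      using n \<kappa>_pos by (simp add: powr_divide powr_diff powr_numeral)
    finally have bump: "gagliardo s (bump n) \<le> ennreal (16 * C * (2 * \<kappa>) powr (2 * s) * real n powr (2 - 2 * s))" .
    have "gagliardo s (tooth_bump n) \<le> ennreal (C * (3 * \<kappa> * real n) powr (2 * s)) * emeasure lborel (tooth_zone n)"
      using n \<kappa>_pos closed_tooth_zone
      by (intro C(2) tooth_bump_lipschitz tooth_bump_outside osc tooth_bump_range) auto
    also have "\<dots> \<le> ennreal (C * (3 * \<kappa> * real n) powr (2 * s)) * ennreal (160 * real n)"
      by (intro mult_left_mono emeasure_tooth_zone_le n) simp
    also have "\<dots> = ennreal (C * (3 * \<kappa> * real n) powr (2 * s) * (160 * real n))"
      using C(1) by (subst ennreal_mult') auto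
    also have "C * (3 * \<kappa> * real n) powr (2 * s) * (160 * real n)
        = 160 * C * (3 * \<kappa>) powr (2 * s) * real n powr (1 + 2 * s)"
      using n \<kappa>_pos by (simp add: powr_mult powr_add)
    finally have tooth: "gagliardo s (tooth_bump n) \<le> ennreal (160 * C * (3 * \<kappa>) powr (2 * s) * real n powr (1 + 2 * s))" .
    have "continuous_on UNIV (bump n)" "continuous_on UNIV (tooth_bump n)"
      using Ck_bump[of 0] Ck_tooth_bump[of 0] by auto
    then have "gagliardo s (test_fun n) \<le> 2 * gagliardo s (bump n) + 2 * gagliardo s (tooth_bump n)"
      unfolding test_fun_def by (intro gagliardo_diff_le borel_measurable_continuous_onI)
    also have "\<dots> \<le> 2 * ennreal (16 * C * (2 * \<kappa>) powr (2 * s) * real n powr (2 - 2 * s))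
        + 2 * ennreal (160 * C * (3 * \<kappa>) powr (2 * s) * real n powr (1 + 2 * s))"
      by (intro add_mono mult_left_mono bump tooth) auto
    also have "\<dots> = ennreal (32 * C * (2 * \<kappa>) powr (2 * s) * real n powr (2 - 2 * s)
        + 320 * C * (3 * \<kappa>) powr (2 * s) * real n powr (1 + 2 * s))"
      using C(1) by (simp add: ennreal_plus ennreal_mult' mult.assoc flip: mult.assoc[of 2])
    finally show "gagliardo s (test_fun n) \<le> ennreal (32 * C * (2 * \<kappa>) powr (2 * s) * real n powr (2 - 2 * s)
        + 320 * C * (3 * \<kappa>) powr (2 * s) * real n powr (1 + 2 * s))" .
    qed
  qed
qed

text \<open>Dividing the energy by \<open>n\<^sup>2\<close> leaves \<open>A n powr (-2 s) + B n powr (2 s - 1)\<close>; the second term tends to \<open>0\<close> because \<open>s < 1 / 2\<close>.\<close>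

lemma P2_comb_eq_0:
  assumes s: "0 < s" "s < 1 / 2"
  shows "P2 s comb = 0"
proof (rule P2_eq_0I)
  fix \<epsilon> :: real assume \<epsilon>: "\<epsilon> > 0"
  obtain A B where AB: "\<And>n. n \<ge> 1 \<Longrightarrow> gagliardo s (test_fun n)
    \<le> ennreal (A * real n powr (2 - 2 * s) + B * real n powr (1 + 2 * s))"
    using test_fun_energy[of s] s by auto
  have "((\<lambda>n. A * real n powr (- (2 * s)) + B * real n powr (2 * s - 1)) \<longlongrightarrow> A * 0 + B * 0) sequentially"
    using s by (intro tendsto_intros tendsto_neg_powr filterlim_real_sequentially) auto
  then have "eventually (\<lambda>n. A * real n powr (- (2 * s)) + B * real n powr (2 * s - 1) < 2 * \<epsilon>) sequentially"
    using \<epsilon> by (intro order_tendstoD(2)[where y = 0]) auto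
  with eventually_ge_at_top[of 80]
  have "eventually (\<lambda>n. n \<ge> 80 \<and> A * real n powr (- (2 * s)) + B * real n powr (2 * s - 1) < 2 * \<epsilon>) sequentially"
    by eventually_elim simp
  from eventually_happens'[OF sequentially_bot this] obtain n :: nat where n: "n \<ge> 80"
    and small: "A * real n powr (- (2 * s)) + B * real n powr (2 * s - 1) < 2 * \<epsilon>"
    by blast
  have "A * real n powr (2 - 2 * s) + B * real n powr (1 + 2 * s)
      = (A * real n powr (- (2 * s)) + B * real n powr (2 * s - 1)) * (real n)\<^sup>2"
  proof -
    have "real n powr (2 - 2 * s) = real n powr (- (2 * s)) * (real n)\<^sup>2"
      "real n powr (1 + 2 * s) = real n powr (2 * s - 1) * (real n)\<^sup>2"
      using n powr_add[of "real n" "- (2 * s)" 2] powr_add[of "real n" "2 * s - 1" 2] by auto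
    then show ?thesis by (simp add: algebra_simps)
  qed
  also have "\<dots> \<le> 2 * \<epsilon> * (real n)\<^sup>2"
    using small by (intro mult_right_mono) auto
  finally have "gagliardo s (test_fun n) \<le> ennreal (2 * \<epsilon> * (real n)\<^sup>2)"
    using AB[of n] n by (auto elim!: order.trans intro: ennreal_leI)
  also have "\<dots> = ennreal \<epsilon> * ennreal (2 * (real n)\<^sup>2)"
    using \<epsilon> by (simp add: mult_ac flip: ennreal_mult')
  also have "\<dots> \<le> ennreal \<epsilon> * L2sq comb (test_fun n)"
    by (intro mult_left_mono L2sq_test_fun_ge n) simp
  finally have "gagliardo s (test_fun n) \<le> ennreal \<epsilon> * L2sq comb (test_fun n)" .
  moreover have "0 < ennreal (2 * (real n)\<^sup>2)" using n by simp
  then have "0 < L2sq comb (test_fun n)"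
    using L2sq_test_fun_ge[OF n] by (rule less_le_trans)
  ultimately show "\<exists>\<phi>\<in>Cc_infinity comb. 0 < L2sq comb \<phi> \<and> gagliardo s \<phi> \<le> ennreal \<epsilon> * L2sq comb \<phi>"
    using test_fun_in_Cc_infinity[of n] n by auto
qed

end

theorem theorem1p2:
  fixes s :: real
  assumes "0 < s" and "s < 1 / 2"
  shows "\<exists>D :: (real ^ 2) set. open D \<and> connected D \<and> D \<noteq> {} \<and> simply_connected D \<and>
    (extended_finite_ball D \<and> BC D < \<infinity>) \<and> (\<not> FP s D \<and> P2 s D = 0)"
proof -
  obtain \<beta> \<kappa> where "smooth_cutoff \<beta> \<kappa>"
    using smooth_cutoff_exists by blast
  then have P2: "P2 s comb = 0"
    using assms by (rule smooth_cutoff.P2_comb_eq_0)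
  have sc: "simply_connected comb"
    by (rule contractible_imp_simply_connected[OF contractible_comb])
  then have "connected comb"
    by (rule simply_connected_imp_connected)
  moreover have "(\<chi> i. - 1 / 2) \<in> comb" by (simp add: comb_def)
  moreover have "BC comb < \<infinity>"
    using BC_comb_le by (rule le_less_trans) simp
  ultimately show ?thesis
    using open_comb sc P2 by (intro exI[of _ comb]) (auto simp: extended_finite_ball_def FP_def)
qed

end
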